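(* Let $(a_i)$ be a computable increasing sequence of rational numbers converging to a real $\alpha$. Assume that for every rational $\varepsilon>0$ one can effectively (uniformly in $\varepsilon$) find a lower semicomputable sequence $(h_i)$ of non-negative reals such that $\sum_i h_i<\varepsilon$ and $\alpha\le a_i+h_i+h_{i+1}+h_{i+2}+\cdots$ for some $i$. Then $\alpha$ is not Martin-Löf random.
   Context: A sequence $(h_i)$ of reals is lower semicomputable if $h_i$ is lower semicomputable uniformly in $i$: there is an algorithm that, given $i$, produces an increasing sequence of rationals converging to $h_i$. *)

theory Defs
  imports "HOL-Analysis.Analysis" "HOL-Library.Nat_Bijection"
begin

text \<open>
  Total computable functions are the general recursive functions: the closure of the basic functions
  under composition, primitive recursion and minimisation of regular functions.
  A \<open>k\<close>-ary function is represented on lists; only its values on lists of length \<open>k\<close> matter.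
\<close>

inductive general_recursive :: "nat \<Rightarrow> (nat list \<Rightarrow> nat) \<Rightarrow> bool" where
  zero: "general_recursive k (\<lambda>xs. 0)"
| succ: "general_recursive 1 (\<lambda>xs. Suc (xs ! 0))"
| proj: "i < k \<Longrightarrow> general_recursive k (\<lambda>xs. xs ! i)"
| comp: "general_recursive (length gs) f \<Longrightarrow> (\<And>g. g \<in> set gs \<Longrightarrow> general_recursive k g) \<Longrightarrow>
    general_recursive k (\<lambda>xs. f (map (\<lambda>g. g xs) gs))"
| prim_rec: "general_recursive k f \<Longrightarrow> general_recursive (k + 2) g \<Longrightarrow>
    general_recursive (k + 1) (\<lambda>xs. rec_nat (f (tl xs)) (\<lambda>n r. g (n # r # tl xs)) (hd xs))"
| minimise: "general_recursive (k + 1) f \<Longrightarrow> (\<And>xs. length xs = k \<Longrightarrow> \<exists>y. f (y # xs) = 0) \<Longrightarrow>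
    general_recursive k (\<lambda>xs. LEAST y. f (y # xs) = 0)"

text \<open>
  A surjective numbering of the rationals. Algorithms read and write rational numbers through
  their (non-unique) codes.
\<close>

definition rat_decode :: "nat \<Rightarrow> rat" where
  "rat_decode c = (case prod_decode c of (a, b) \<Rightarrow> of_int (int_decode a) / of_nat (Suc b))"

lemma surj_rat_decode: "surj rat_decode"
proof -
  have "\<exists>c. rat_decode c = x" for x
  proof -
    obtain p q where x: "x = Fract p q" and q: "q > 0"
      by (cases x) auto
    have "rat_decode (prod_encode (int_encode p, nat q - 1)) = of_int p / of_nat (Suc (nat q - 1))"
      by (simp add: rat_decode_def)
    also have "of_nat (Suc (nat q - 1)) = (of_int q :: rat)"
      using q by simp
    finally show ?thesis
      using x by (auto simp: Fract_of_int_quotient)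
  qed
  then show ?thesis
    by (metis surjI)
qed

definition computable_rat_seq :: "(nat \<Rightarrow> rat) \<Rightarrow> bool" where
  "computable_rat_seq a \<longleftrightarrow> (\<exists>g. general_recursive 1 g \<and> (\<forall>i. a i = rat_decode (g [i])))"

definition approximates_from_below :: "(nat \<Rightarrow> rat) \<Rightarrow> real \<Rightarrow> bool" where
  "approximates_from_below r x \<longleftrightarrow> mono r \<and> (\<lambda>n. real_of_rat (r n)) \<longlonglongrightarrow> x"

definition lower_semicomputable_seq :: "(nat \<Rightarrow> real) \<Rightarrow> bool" where
  "lower_semicomputable_seq h \<longleftrightarrow>
    (\<exists>g. general_recursive 2 g \<and>
      (\<forall>i. approximates_from_below (\<lambda>n. rat_decode (g [i, n])) (h i)))"

text \<open>
  The sequences \<open>h \<epsilon>\<close> are lower semicomputable uniformly in the rational \<open>\<epsilon> > 0\<close>: a single algorithm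
  receives (a code of) \<open>\<epsilon>\<close> as an additional input. Nothing is required for \<open>\<epsilon> \<le> 0\<close>.
\<close>

definition uniformly_lower_semicomputable :: "(rat \<Rightarrow> nat \<Rightarrow> real) \<Rightarrow> bool" where
  "uniformly_lower_semicomputable h \<longleftrightarrow>
    (\<exists>g. general_recursive 3 g \<and>
      (\<forall>e i. rat_decode e > 0 \<longrightarrow>
        approximates_from_below (\<lambda>n. rat_decode (g [e, i, n])) (h (rat_decode e) i)))"

lemma general_recursive_const: "general_recursive k (\<lambda>xs. c)"
proof (induction c)
  case 0
  show ?case by (rule zero)
next
  case (Suc c)
  have "general_recursive k (\<lambda>xs. (\<lambda>ys. Suc (ys ! 0)) (map (\<lambda>g. g xs) [\<lambda>xs. c]))"
    by (rule comp) (use succ Suc in auto)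
  then show ?case by simp
qed

lemma uniformly_lower_semicomputable_imp_seq:
  assumes "uniformly_lower_semicomputable h" "\<epsilon> > 0"
  shows "lower_semicomputable_seq (h \<epsilon>)"
proof -
  obtain g where g: "general_recursive 3 g"
    and lim: "\<And>e i. rat_decode e > 0 \<Longrightarrow>
      approximates_from_below (\<lambda>n. rat_decode (g [e, i, n])) (h (rat_decode e) i)"
    using assms(1) unfolding uniformly_lower_semicomputable_def by blast
  obtain e where e: "rat_decode e = \<epsilon>"
    using surj_rat_decode by (metis surjD)
  have "general_recursive 2 (\<lambda>xs. g (map (\<lambda>g. g xs) [\<lambda>xs. e, \<lambda>xs. xs ! 0, \<lambda>xs. xs ! 1]))"
    by (rule comp) (use g general_recursive_const proj[of 0 2] proj[of 1 2] in
      \<open>auto simp: numeral_3_eq_3\<close>)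
  moreover have "\<forall>i. approximates_from_below (\<lambda>n. rat_decode (g [e, i, n])) (h \<epsilon> i)"
    using lim[of e] e assms(2) by simp
  ultimately show ?thesis
    unfolding lower_semicomputable_seq_def
    by (intro exI[of _ "\<lambda>xs. g (map (\<lambda>g. g xs) [\<lambda>xs. e, \<lambda>xs. xs ! 0, \<lambda>xs. xs ! 1])"]) simp
qed

text \<open>
  Martin-Loef randomness on the real line with Lebesgue measure. Each \<open>U n\<close> is the union of a
  sequence of open rational intervals, computable uniformly in \<open>n\<close>. An enumeration may list empty
  intervals (left end not below right end), so it can be taken to be total.
\<close>

definition uniformly_effectively_open :: "(nat \<Rightarrow> real set) \<Rightarrow> bool" where
  "uniformly_effectively_open U \<longleftrightarrow>
    (\<exists>p q. general_recursive 2 p \<and> general_recursive 2 q \<and>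
      (\<forall>n. U n = (\<Union>k. {real_of_rat (rat_decode (p [n, k])) <..<
                        real_of_rat (rat_decode (q [n, k]))})))"

definition martin_loef_test :: "(nat \<Rightarrow> real set) \<Rightarrow> bool" where
  "martin_loef_test U \<longleftrightarrow>
    uniformly_effectively_open U \<and> (\<forall>n. emeasure lborel (U n) \<le> ennreal ((1 / 2) ^ n))"

definition martin_loef_random :: "real \<Rightarrow> bool" where
  "martin_loef_random x \<longleftrightarrow> (\<forall>U. martin_loef_test U \<longrightarrow> x \<notin> (\<Inter>n. U n))"

end

theory Submission
  imports Defs
begin

text \<open>
  Picture \<open>h i\<close> as an amount of paint that is poured at \<open>a i\<close> and covers the nearest unpainted
  points to the right. Since \<open>a\<close> is increasing, the painted set is the union of the intervals
  from \<open>a (i + d)\<close> to \<open>a i + (\<Sum>j<d. h (i + j))\<close>, so it is effectively open, and its measure is at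
  most the total amount of paint. Pouring twice the given amounts makes the hypothesis strict as soon
  as \<open>a i < \<alpha>\<close> for all \<open>i\<close>, and then \<open>\<alpha>\<close> gets painted. If \<open>a i = \<alpha>\<close> for some \<open>i\<close>,
  then \<open>\<alpha>\<close> is rational and therefore not random.
\<close>

section \<open>Computable functions\<close>

text \<open>
  \<^const>\<open>general_recursive\<close> is sensitive to the values on lists of the wrong length; this
  extensional version is not.
\<close>

definition computable :: "nat \<Rightarrow> (nat list \<Rightarrow> nat) \<Rightarrow> bool" where
  "computable k f \<longleftrightarrow> (\<exists>f'. general_recursive k f' \<and> (\<forall>xs. length xs = k \<longrightarrow> f' xs = f xs))"

section \<open>Closure under composition, primitive recursion and minimisation\<close>

lemma general_recursive_imp_computable: "general_recursive k f \<Longrightarrow> computable k f"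
  unfolding computable_def by blast

lemma computable_cong:
  assumes "computable k f" "\<And>xs. length xs = k \<Longrightarrow> f xs = g xs"
  shows "computable k g"
  using assms unfolding computable_def by auto

lemma computable_const: "computable k (\<lambda>xs. c)"
  by (intro general_recursive_imp_computable general_recursive_const)

lemma computable_nth: "i < k \<Longrightarrow> computable k (\<lambda>xs. xs ! i)"
  by (intro general_recursive_imp_computable general_recursive.proj)

lemma computable_comp:
  assumes "computable (length gs) f" "\<And>g. g \<in> set gs \<Longrightarrow> computable k g"
  shows "computable k (\<lambda>xs. f (map (\<lambda>g. g xs) gs))"
proof -
  obtain f' where f': "general_recursive (length gs) f'"
    "\<And>xs. length xs = length gs \<Longrightarrow> f' xs = f xs"
    using assms(1) unfolding computable_def by blast
  obtain T where T: "\<And>g. g \<in> set gs \<Longrightarrow> general_recursive k (T g)"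
    "\<And>g xs. g \<in> set gs \<Longrightarrow> length xs = k \<Longrightarrow> T g xs = g xs"
    using assms(2) unfolding computable_def by metis
  have "general_recursive k (\<lambda>xs. f' (map (\<lambda>g. g xs) (map T gs)))"
    by (rule general_recursive.comp) (use f' T in auto)
  moreover have "f' (map (\<lambda>g. g xs) (map T gs)) = f (map (\<lambda>g. g xs) gs)" if "length xs = k" for xs
  proof -
    have "map (\<lambda>g. g xs) (map T gs) = map (\<lambda>g. g xs) gs"
      using T(2) that by simp
    then show ?thesis
      using f'(2)[of "map (\<lambda>g. g xs) (map T gs)"] by (simp del: map_map)
  qed
  ultimately show ?thesis
    unfolding computable_def by blast
qed

lemma computable_list1:
  assumes "computable 1 f" "computable k g"
  shows "computable k (\<lambda>xs. f [g xs])"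
  using computable_comp[of "[g]" f k] assms by simp

lemma computable_list2:
  assumes "computable 2 f" "computable k g1" "computable k g2"
  shows "computable k (\<lambda>xs. f [g1 xs, g2 xs])"
  using computable_comp[of "[g1, g2]" f k] assms by (auto simp: numeral_2_eq_2)

lemma computable_list3:
  assumes "computable 3 f" "computable k g1" "computable k g2" "computable k g3"
  shows "computable k (\<lambda>xs. f [g1 xs, g2 xs, g3 xs])"
  using computable_comp[of "[g1, g2, g3]" f k] assms by (auto simp: numeral_3_eq_3)

lemma computable_comp1:
  assumes "computable 1 (\<lambda>xs. F (xs ! 0))" "computable k g"
  shows "computable k (\<lambda>xs. F (g xs))"
  using computable_list1[OF assms] by simp

lemma computable_comp2:
  assumes "computable 2 (\<lambda>xs. F (xs ! 0) (xs ! 1))" "computable k g1" "computable k g2"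
  shows "computable k (\<lambda>xs. F (g1 xs) (g2 xs))"
  using computable_list2[OF assms] by simp

text \<open>Serves primitive recursion, whose recursion variable sits at the head of the list: a
  computed bound is put there, while projections keep the old arguments as parameters.\<close>

lemma computable_Cons:
  assumes "computable (k + 1) f" "computable k g"
  shows "computable k (\<lambda>xs. f (g xs # xs))"
proof -
  define gs where "gs = g # map (\<lambda>i xs. xs ! i) [0..<k]"
  have "computable k (\<lambda>xs. f (map (\<lambda>g. g xs) gs))"
    by (rule computable_comp) (use assms in \<open>auto simp: gs_def intro: computable_nth\<close>)
  then show ?thesis
  proof (rule computable_cong)
    fix xs :: "nat list"
    assume "length xs = k"
    then have "map (\<lambda>g. g xs) gs = g xs # xs"
      using map_nth[of xs] by (simp add: gs_def comp_def)
    then show "f (map (\<lambda>g. g xs) gs) = f (g xs # xs)"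
      by simp
  qed
qed

lemma computable_rec_nat:
  assumes "computable k f" "computable (k + 2) g" "computable k d"
  shows "computable k (\<lambda>xs. rec_nat (f xs) (\<lambda>n r. g (n # r # xs)) (d xs))"
proof -
  obtain f' where f': "general_recursive k f'" "\<And>xs. length xs = k \<Longrightarrow> f' xs = f xs"
    using assms(1) unfolding computable_def by blast
  obtain g' where g': "general_recursive (k + 2) g'" "\<And>xs. length xs = k + 2 \<Longrightarrow> g' xs = g xs"
    using assms(2) unfolding computable_def by blast
  have "computable (k + 1) (\<lambda>xs. rec_nat (f' (tl xs)) (\<lambda>n r. g' (n # r # tl xs)) (hd xs))"
    by (intro general_recursive_imp_computable general_recursive.prim_rec f' g')
  from computable_Cons[OF this assms(3)] show ?thesis
    by (rule computable_cong) (simp add: f' g')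
qed

lemma computable_Least:
  assumes "computable (k + 1) f" "\<And>xs. length xs = k \<Longrightarrow> \<exists>y. f (y # xs) = 0"
  shows "computable k (\<lambda>xs. LEAST y. f (y # xs) = 0)"
proof -
  obtain f' where f': "general_recursive (k + 1) f'" "\<And>xs. length xs = k + 1 \<Longrightarrow> f' xs = f xs"
    using assms(1) unfolding computable_def by blast
  have "computable k (\<lambda>xs. LEAST y. f' (y # xs) = 0)"
    by (intro general_recursive_imp_computable general_recursive.minimise)
      (use f' assms(2) in auto)
  then show ?thesis
    by (rule computable_cong) (simp add: f')
qed

lemma computable_Suc:
  assumes "computable k f"
  shows "computable k (\<lambda>xs. Suc (f xs))"
  by (rule computable_comp1[OF _ assms])
    (rule general_recursive_imp_computable[OF general_recursive.succ])

text \<open>Reads computability off a recursion equation. No assumption on \<open>F 0\<close> is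
  needed, since it is a constant.\<close>

lemma computable_by_recursion:
  assumes "computable 2 (\<lambda>xs. G (xs ! 0) (xs ! 1))" "\<And>n. F (Suc n) = G n (F n)"
  shows "computable 1 (\<lambda>xs. F (xs ! 0))"
proof -
  have "computable 3 (\<lambda>xs. G (xs ! 0) (xs ! 1))"
    by (intro computable_comp2[OF assms(1)] computable_nth) auto
  then have "computable 1 (\<lambda>xs. rec_nat (F 0) (\<lambda>n r. (\<lambda>ys. G (ys ! 0) (ys ! 1)) (n # r # xs)) (xs ! 0))"
    by (intro computable_rec_nat computable_const computable_nth) (auto simp: numeral_3_eq_3)
  moreover have "rec_nat (F 0) (\<lambda>n r. G n r) m = F m" for m
    by (induction m) (auto simp: assms(2))
  ultimately show ?thesis
    by simp
qed

lemma computable_by_recursion2: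
  assumes "computable 1 (\<lambda>xs. F 0 (xs ! 0))"
    and "computable 3 (\<lambda>xs. G (xs ! 0) (xs ! 1) (xs ! 2))"
    and "\<And>n m. F (Suc n) m = G n (F n m) m"
  shows "computable 2 (\<lambda>xs. F (xs ! 0) (xs ! 1))"
proof -
  \<comment> \<open>The recursion step sees the counter, the previous value and then both original
    arguments. Position 2 holds the recursion bound and is skipped; the parameter \<open>m\<close>
    is at position 3.\<close>
  have "computable 4 (\<lambda>xs. (\<lambda>ys. G (ys ! 0) (ys ! 1) (ys ! 2)) [xs ! 0, xs ! 1, xs ! 3])"
    by (rule computable_list3[OF assms(2)]) (auto intro: computable_nth)
  moreover have "computable 2 (\<lambda>xs. F 0 (xs ! 1))"
    by (rule computable_comp1[OF assms(1)]) (simp add: computable_nth)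
  ultimately have "computable 2 (\<lambda>xs. rec_nat (F 0 (xs ! 1))
      (\<lambda>n r. (\<lambda>ys. G (ys ! 0) (ys ! 1) (ys ! 3)) (n # r # xs)) (xs ! 0))"
    by (intro computable_rec_nat computable_nth) auto
  moreover have "rec_nat (F 0 m) (\<lambda>n r. G n r m) n = F n m" for n m
    by (induction n) (auto simp: assms(3))
  ultimately show ?thesis
    by (simp add: numeral_3_eq_3)
qed

section \<open>Arithmetic on the natural numbers\<close>

lemma computable_add:
  assumes "computable k f" "computable k g"
  shows "computable k (\<lambda>xs. f xs + g xs)"
  by (rule computable_comp2[OF computable_by_recursion2[where G = "\<lambda>_ r _. Suc r"] assms])
    (auto intro!: computable_Suc computable_nth)

lemma computable_mult:
  assumes "computable k f" "computable k g"
  shows "computable k (\<lambda>xs. f xs * g xs)"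
  by (rule computable_comp2[OF computable_by_recursion2[where G = "\<lambda>_ r m. m + r"] assms])
    (auto intro!: computable_add computable_nth computable_const)

lemma computable_pred:
  assumes "computable k f"
  shows "computable k (\<lambda>xs. f xs - 1)"
  by (rule computable_comp1[OF computable_by_recursion[where G = "\<lambda>n _. n"] assms])
    (auto intro!: computable_nth)

text \<open>The recursion runs over the subtrahend, iterating the predecessor; hence
  \<open>F\<close> has its arguments exchanged and the assumptions are passed in reverse
  order.\<close>

lemma computable_diff:
  assumes "computable k f" "computable k g"
  shows "computable k (\<lambda>xs. f xs - g xs)"
  by (rule computable_comp2[OF computable_by_recursion2[where G = "\<lambda>_ r _. r - 1" and
          F = "\<lambda>m n. n - m"] assms(2,1)])
    (auto intro!: computable_pred[unfolded One_nat_def] computable_nth)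

lemma computable_power2:
  assumes "computable k f"
  shows "computable k (\<lambda>xs. 2 ^ f xs)"
  by (rule computable_comp1[OF computable_by_recursion[where G = "\<lambda>_ r. r + r"] assms])
    (auto intro!: computable_add computable_nth)

lemma computable_mod2:
  assumes "computable k f"
  shows "computable k (\<lambda>xs. f xs mod 2)"
  by (rule computable_comp1[OF computable_by_recursion[where G = "\<lambda>_ r. 1 - r"] assms])
    (auto intro!: computable_diff computable_nth computable_const simp: mod_Suc)

text \<open>Rests on \<open>Suc n div 2 = n div 2 + n mod 2\<close>.\<close>

lemma computable_div2:
  assumes "computable k f"
  shows "computable k (\<lambda>xs. f xs div 2)"
  by (rule computable_comp1[OF computable_by_recursion[where G = "\<lambda>n r. r + n mod 2"] assms])
    (auto intro!: computable_add computable_mod2 computable_nth, presburger)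

lemma computable_triangle:
  assumes "computable k f"
  shows "computable k (\<lambda>xs. triangle (f xs))"
  by (rule computable_comp1[OF computable_by_recursion[where G = "\<lambda>n r. r + Suc n"] assms])
    (auto intro!: computable_add computable_Suc computable_nth)

lemma computable_prod_encode:
  assumes "computable k f" "computable k g"
  shows "computable k (\<lambda>xs. prod_encode (f xs, g xs))"
  unfolding prod_encode_def by (auto intro!: computable_add computable_triangle assms)

section \<open>Inverting the pairing function\<close>

lemma triangle_mono: "m \<le> n \<Longrightarrow> triangle m \<le> triangle n"
  by (induction rule: dec_induct) auto

lemma triangle_prod_decode:
  "triangle (fst (prod_decode c) + snd (prod_decode c)) + fst (prod_decode c) = c"
  using prod_decode_inverse[of c] by (simp add: prod_encode_def split_beta)

text \<open>A code has the form \<open>triangle (a + b) + a\<close> with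
  \<open>a \<le> a + b\<close>, so it lies from \<open>triangle (a + b)\<close> up to but excluding
  \<open>triangle (Suc (a + b))\<close>, and a search finds the diagonal \<open>a + b\<close>. The
  test \<open>c < triangle (Suc t)\<close> is written as a vanishing truncated difference, the shape
  that minimisation expects.\<close>

lemma fst_prod_decode_add_snd:
  "fst (prod_decode c) + snd (prod_decode c) = (LEAST t. Suc c - triangle (Suc t) = 0)"
proof -
  define a b where "a = fst (prod_decode c)" and "b = snd (prod_decode c)"
  then have c: "c = triangle (a + b) + a"
    using triangle_prod_decode[of c] by simp
  have "(LEAST t. Suc c - triangle (Suc t) = 0) = a + b"
  proof (rule Least_equality)
    show "Suc c - triangle (Suc (a + b)) = 0"
      by (simp add: c)
  next
    fix t assume "Suc c - triangle (Suc t) = 0"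
    then have "triangle (a + b) < triangle (Suc t)"
      using c by simp
    then show "a + b \<le> t"
      by (metis linorder_not_le not_less_eq_eq triangle_mono)
  qed
  then show ?thesis
    by (simp add: a_def b_def)
qed

text \<open>Not circular as a computation: on the right the component occurs only inside the sum of
  both components, which the search has already found.\<close>

lemma fst_prod_decode:
  "fst (prod_decode c) = c - triangle (fst (prod_decode c) + snd (prod_decode c))"
  using triangle_prod_decode[of c] by linarith

lemma computable_fst_prod_decode_add_snd:
  assumes "computable k f"
  shows "computable k (\<lambda>xs. fst (prod_decode (f xs)) + snd (prod_decode (f xs)))"
proof (rule computable_comp1[where F = "\<lambda>c. fst (prod_decode c) + snd (prod_decode c)", OF _ assms])
  have "computable 1 (\<lambda>xs. LEAST t. (\<lambda>ys. Suc (ys ! 1) - triangle (Suc (ys ! 0))) (t # xs) = 0)"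
  proof (rule computable_Least)
    show "computable (1 + 1) (\<lambda>ys. Suc (ys ! 1) - triangle (Suc (ys ! 0)))"
      by (intro computable_diff computable_triangle computable_Suc computable_nth) auto
    show "\<exists>y. Suc ((y # xs) ! 1) - triangle (Suc ((y # xs) ! 0)) = 0" for xs
      \<comment> \<open>The search succeeds at the code itself at the latest, because
        \<open>triangle (Suc c) \<ge> Suc c\<close>.\<close>
      by (rule exI[of _ "xs ! 0"]) simp
  qed
  then show "computable 1 (\<lambda>xs. fst (prod_decode (xs ! 0)) + snd (prod_decode (xs ! 0)))"
    by (simp add: fst_prod_decode_add_snd)
qed

lemma computable_fst_prod_decode:
  assumes "computable k f"
  shows "computable k (\<lambda>xs. fst (prod_decode (f xs)))"
  by (rule computable_cong[OF computable_diff[OF assms computable_triangle[OF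
          computable_fst_prod_decode_add_snd[OF assms]]]]) (rule fst_prod_decode[symmetric])

lemma computable_snd_prod_decode:
  assumes "computable k f"
  shows "computable k (\<lambda>xs. snd (prod_decode (f xs)))"
proof -
  have "computable k (\<lambda>xs. fst (prod_decode (f xs)) + snd (prod_decode (f xs)) - fst (prod_decode (f xs)))"
    by (intro computable_diff computable_fst_prod_decode_add_snd computable_fst_prod_decode assms)
  then show ?thesis
    by simp
qed

section \<open>Computable rational-valued functions\<close>

definition computable_rat :: "nat \<Rightarrow> (nat list \<Rightarrow> rat) \<Rightarrow> bool" where
  "computable_rat k f \<longleftrightarrow> (\<exists>g. computable k g \<and> (\<forall>xs. length xs = k \<longrightarrow> f xs = rat_decode (g xs)))"

lemma computable_rat_decode: "computable k f \<Longrightarrow> computable_rat k (\<lambda>xs. rat_decode (f xs))"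
  unfolding computable_rat_def by blast

text \<open>Nonnegative integers have even codes and negative ones odd codes; truncated subtraction
  lets at most one of the two summands survive, which replaces a case distinction.\<close>

lemma int_encode_diff: "int_encode (int x - int y) = 2 * (x - y) + (2 * (y - x) - 1)"
  by (auto simp: int_encode_def sum_encode_def nat_diff_distrib)

lemma int_decode_eq:
  "int_decode n = int ((1 - n mod 2) * (n div 2)) - int (n mod 2 * Suc (n div 2))"
  by (auto simp: int_decode_def sum_decode_def odd_iff_mod_2_eq_one)

text \<open>Together with \<open>computable_rat_fractionE\<close> this reduces rational arithmetic
  to natural numbers. Codes are not unique, so fractions never have to be reduced.\<close>

lemma computable_rat_fraction:
  assumes "computable k x" "computable k y" "computable k z"
  shows "computable_rat k (\<lambda>xs. (of_nat (x xs) - of_nat (y xs)) / of_nat (Suc (z xs)))"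
proof -
  have "computable k (\<lambda>xs. prod_encode (int_encode (int (x xs) - int (y xs)), z xs))"
    unfolding int_encode_diff
    by (intro computable_prod_encode computable_add computable_mult computable_diff
        computable_const assms)
  from computable_rat_decode[OF this] show ?thesis
    by (simp add: rat_decode_def)
qed

lemma computable_rat_const: "computable_rat k (\<lambda>xs. c)"
  using computable_rat_decode[OF computable_const] surj_rat_decode by (metis surjD)

lemma computable_rat_fractionE:
  assumes "computable_rat k f"
  obtains x y z where "computable k x" "computable k y" "computable k z"
    "\<And>xs. length xs = k \<Longrightarrow> f xs = (of_nat (x xs) - of_nat (y xs)) / of_nat (Suc (z xs))"
proof -
  obtain g where g: "computable k g" "\<And>xs. length xs = k \<Longrightarrow> f xs = rat_decode (g xs)"
    using assms unfolding computable_rat_def by blast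
  define c where "c xs = fst (prod_decode (g xs))" for xs
  have c: "computable k c"
    unfolding c_def using g(1) by (rule computable_fst_prod_decode)
  show thesis
  proof
    \<comment> \<open>The parity of the numerator's code gives its sign, so one of the two natural
      numbers is always zero.\<close>
    show "computable k (\<lambda>xs. (1 - c xs mod 2) * (c xs div 2))"
      by (intro computable_mult computable_diff computable_mod2 computable_div2 computable_const c)
    show "computable k (\<lambda>xs. c xs mod 2 * Suc (c xs div 2))"
      by (intro computable_mult computable_mod2 computable_div2 computable_Suc c)
    show "computable k (\<lambda>xs. snd (prod_decode (g xs)))"
      using g(1) by (rule computable_snd_prod_decode)
    fix xs :: "nat list"
    assume "length xs = k"
    then have "f xs = of_int (int_decode (c xs)) / of_nat (Suc (snd (prod_decode (g xs))))"
      by (simp add: g(2) rat_decode_def c_def split_beta)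
    then show "f xs = (of_nat ((1 - c xs mod 2) * (c xs div 2)) - of_nat (c xs mod 2 * Suc (c xs div 2)))
        / of_nat (Suc (snd (prod_decode (g xs))))"
      by (simp only: int_decode_eq of_int_diff of_int_of_nat_eq)
  qed
qed

lemma computable_rat_cong:
  assumes "computable_rat k f" "\<And>xs. length xs = k \<Longrightarrow> f xs = g xs"
  shows "computable_rat k g"
  using assms unfolding computable_rat_def by auto

lemma computable_rat_add:
  assumes "computable_rat k f" "computable_rat k g"
  shows "computable_rat k (\<lambda>xs. f xs + g xs)"
proof -
  obtain x y z where f: "computable k x" "computable k y" "computable k z"
    "\<And>xs. length xs = k \<Longrightarrow> f xs = (of_nat (x xs) - of_nat (y xs)) / of_nat (Suc (z xs))"
    using assms(1) by (rule computable_rat_fractionE) blast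
  obtain x' y' z' where g: "computable k x'" "computable k y'" "computable k z'"
    "\<And>xs. length xs = k \<Longrightarrow> g xs = (of_nat (x' xs) - of_nat (y' xs)) / of_nat (Suc (z' xs))"
    using assms(2) by (rule computable_rat_fractionE) blast
  \<comment> \<open>Cross-multiplication. The fraction form adds one to the stored denominator,
    hence the \<open>- 1\<close> after the product of the denominators.\<close>
  have "computable_rat k (\<lambda>xs.
      (of_nat (x xs * Suc (z' xs) + x' xs * Suc (z xs)) - of_nat (y xs * Suc (z' xs) + y' xs * Suc (z xs)))
      / of_nat (Suc (Suc (z xs) * Suc (z' xs) - 1)))"
    by (intro computable_rat_fraction computable_add computable_mult computable_Suc computable_pred
        f(1-3) g(1-3))
  then show ?thesis
  proof (rule computable_rat_cong)
    fix xs :: "nat list"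
    assume "length xs = k"
    note fg = f(4)[OF this] g(4)[OF this]
    have "Suc (Suc (z xs) * Suc (z' xs) - 1) = Suc (z xs) * Suc (z' xs)"
      by simp
    then show "(of_nat (x xs * Suc (z' xs) + x' xs * Suc (z xs)) - of_nat (y xs * Suc (z' xs) + y' xs * Suc (z xs)))
      / of_nat (Suc (Suc (z xs) * Suc (z' xs) - 1)) = f xs + g xs"
      unfolding fg by (simp only: of_nat_mult of_nat_add) (simp add: divide_simps, simp add: algebra_simps)
  qed
qed

text \<open>Primitive recursion runs on codes: \<open>s\<close> adds two codes and \<open>z\<close>
  is a code of zero.\<close>

lemma computable_rat_sum:
  assumes "computable_rat (k + 1) f" "computable k d"
  shows "computable_rat k (\<lambda>xs. \<Sum>j<d xs. f (j # xs))"
proof -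
  obtain g where g: "computable (k + 1) g" "\<And>xs. length xs = k + 1 \<Longrightarrow> f xs = rat_decode (g xs)"
    using assms(1) unfolding computable_rat_def by blast
  have "computable_rat 2 (\<lambda>xs. rat_decode (xs ! 0) + rat_decode (xs ! 1))"
    by (intro computable_rat_add computable_rat_decode computable_nth) auto
  then obtain s where s: "computable 2 s"
    and s': "\<And>xs. length xs = 2 \<Longrightarrow> rat_decode (xs ! 0) + rat_decode (xs ! 1) = rat_decode (s xs)"
    unfolding computable_rat_def by blast
  have decode_s: "rat_decode (s [u, v]) = rat_decode u + rat_decode v" for u v
    using s'[of "[u, v]"] by simp
  obtain z where z: "rat_decode z = 0"
    using surj_rat_decode by (metis surjD)
  define r where "r xs = rec_nat z (\<lambda>n r. s [r, g (n # xs)]) (d xs)" for xs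
  \<comment> \<open>The recursion step receives \<open>n # r # xs\<close>, whereas the summand wants
    \<open>n # xs\<close>; these projections drop the accumulator \<open>r\<close>.\<close>
  define gs where "gs = (\<lambda>xs :: nat list. xs ! 0) # map (\<lambda>i xs. xs ! (i + 2)) [0..<k]"
  have "computable (k + 2) (\<lambda>xs. g (map (\<lambda>g. g xs) gs))"
    by (rule computable_comp) (use g(1) in \<open>auto simp: gs_def intro!: computable_nth\<close>)
  then have "computable (k + 2) (\<lambda>xs. g (xs ! 0 # tl (tl xs)))"
  proof (rule computable_cong)
    fix xs :: "nat list"
    assume "length xs = k + 2"
    then have "map (\<lambda>g. g xs) gs = xs ! 0 # tl (tl xs)"
      by (auto simp: gs_def comp_def nth_tl intro!: nth_equalityI)
    then show "g (map (\<lambda>g. g xs) gs) = g (xs ! 0 # tl (tl xs))"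
      by simp
  qed
  then have "computable (k + 2) (\<lambda>xs. s [xs ! 1, g (xs ! 0 # tl (tl xs))])"
    by (intro computable_list2[OF s] computable_nth) auto
  from computable_rec_nat[OF computable_const this assms(2)] have "computable k r"
    by (simp add: r_def[abs_def])
  then have "computable_rat k (\<lambda>xs. rat_decode (r xs))"
    by (rule computable_rat_decode)
  then show ?thesis
  proof (rule computable_rat_cong)
    fix xs :: "nat list"
    assume xs: "length xs = k"
    have "rat_decode (rec_nat z (\<lambda>n r. s [r, g (n # xs)]) m) = (\<Sum>j<m. f (j # xs))" for m
    proof (induction m)
      case (Suc m)
      then show ?case
        using g(2)[of "m # xs"] xs by (simp add: decode_s)
    qed (simp add: z)
    then show "rat_decode (r xs) = (\<Sum>j<d xs. f (j # xs))"
      by (simp add: r_def)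
  qed
qed

lemma computable_rat_half_power:
  assumes "computable k f"
  shows "computable_rat k (\<lambda>xs. (1 / 2) ^ f xs)"
proof -
  have "computable_rat k (\<lambda>xs. (of_nat 1 - of_nat 0) / of_nat (Suc (2 ^ f xs - 1)))"
    by (intro computable_rat_fraction computable_pred computable_power2 computable_const assms)
  then show ?thesis
    by (simp add: power_one_over)
qed

section \<open>Effectively open sets, and non-randomness of rationals\<close>

lemma uniformly_effectively_openI:
  assumes "computable_rat 2 l" "computable_rat 2 u"
    and "\<And>n. U n = (\<Union>k. {real_of_rat (l [n, k]) <..< real_of_rat (u [n, k])})"
  shows "uniformly_effectively_open U"
proof -
  obtain p where p: "general_recursive 2 p" "\<And>xs. length xs = 2 \<Longrightarrow> l xs = rat_decode (p xs)"
    using assms(1) unfolding computable_rat_def computable_def by metis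
  obtain q where q: "general_recursive 2 q" "\<And>xs. length xs = 2 \<Longrightarrow> u xs = rat_decode (q xs)"
    using assms(2) unfolding computable_rat_def computable_def by metis
  show ?thesis
    unfolding uniformly_effectively_open_def using p q assms(3)
    by (intro exI[of _ p] exI[of _ q]) simp
qed

text \<open>The test consists of intervals centred at \<open>x\<close>; radius
  \<open>(1 / 2) ^ Suc n\<close> makes the length exactly \<open>(1 / 2) ^ n\<close>.\<close>

lemma rational_not_martin_loef_random: "\<not> martin_loef_random (real_of_rat x)"
proof -
  define \<epsilon> :: "nat \<Rightarrow> rat" where "\<epsilon> n = (1 / 2) ^ Suc n" for n
  define U where "U n = {real_of_rat (x + - \<epsilon> n) <..< real_of_rat (x + \<epsilon> n)}" for n
  have \<epsilon>: "\<epsilon> n > 0" for n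
    by (simp add: \<epsilon>_def)
  have "computable_rat 2 (\<lambda>xs. (1 / 2) ^ Suc (xs ! 0))"
    by (intro computable_rat_half_power computable_Suc computable_nth) auto
  then have pos: "computable_rat 2 (\<lambda>xs. \<epsilon> (xs ! 0))"
    by (simp add: \<epsilon>_def)
  then obtain p q r where *: "computable 2 p" "computable 2 q" "computable 2 r"
    "\<And>xs. length xs = 2 \<Longrightarrow> \<epsilon> (xs ! 0) = (of_nat (p xs) - of_nat (q xs)) / of_nat (Suc (r xs))"
    by (rule computable_rat_fractionE) blast
  \<comment> \<open>Exchanging the two parts of the numerator negates the fraction.\<close>
  have neg: "computable_rat 2 (\<lambda>xs. - \<epsilon> (xs ! 0))"
    by (rule computable_rat_cong[OF computable_rat_fraction[OF *(2,1,3)]])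
      (simp add: *(4) field_simps)
  have "uniformly_effectively_open U"
    by (rule uniformly_effectively_openI[OF computable_rat_add[OF computable_rat_const neg]
          computable_rat_add[OF computable_rat_const pos]]) (simp add: U_def)
  moreover have "emeasure lborel (U n) \<le> ennreal ((1 / 2) ^ n)" for n
  proof -
    have "emeasure lborel (U n) = ennreal (2 * real_of_rat (\<epsilon> n))"
      using \<epsilon>[of n] by (simp add: U_def of_rat_add of_rat_diff)
    then show ?thesis
      by (simp add: \<epsilon>_def of_rat_mult of_rat_power of_rat_divide)
  qed
  ultimately have "martin_loef_test U"
    by (simp add: martin_loef_test_def)
  moreover have "real_of_rat x \<in> U n" for n
    using \<epsilon>[of n] by (simp add: U_def of_rat_less)
  ultimately show ?thesis
    unfolding martin_loef_random_def by blast
qed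

section \<open>The painted set\<close>

text \<open>The right end of the paint after portions \<open>m 0\<close>, ..., \<open>m n\<close>
  have been poured: a new portion starts at its own point, or where the old paint ends if that is
  further right.\<close>

fun paint_end :: "(nat \<Rightarrow> real) \<Rightarrow> (nat \<Rightarrow> real) \<Rightarrow> nat \<Rightarrow> real" where
  "paint_end a m 0 = a 0 + m 0"
| "paint_end a m (Suc n) = max (paint_end a m n) (a (Suc n)) + m (Suc n)"

text \<open>Portion \<open>i\<close> reaches at least \<open>a i + m i\<close>, and each later
  portion pushes the end on by at least its own amount, as the maximum dominates the previous
  end.\<close>

lemma paint_end_ge:
  assumes "\<And>i. 0 \<le> m i"
  shows "a i + (\<Sum>j\<le>d. m (i + j)) \<le> paint_end a m (i + d)"
proof (induction d)
  case 0
  show ?case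
    by (cases i) auto
next
  case (Suc d)
  then show ?case
    using assms by (simp add: max_def)
qed

text \<open>Portion \<open>Suc n\<close> adds to the earlier set at most an interval of length
  \<open>m (Suc n)\<close>: whatever its interval covers to the left of \<open>?c\<close> has been
  painted before.\<close>

lemma emeasure_painted_le_sum:
  assumes "mono a" "\<And>i. 0 \<le> m i"
  shows "emeasure lborel (\<Union>k\<le>n. {a k <..< paint_end a m k}) \<le> ennreal (\<Sum>j\<le>n. m j)"
proof (induction n)
  case 0
  show ?case
    using assms(2)[of 0] by simp
next
  case (Suc n)
  let ?V = "\<Union>k\<le>n. {a k <..< paint_end a m k}"
  let ?c = "max (paint_end a m n) (a (Suc n))"
  have "(\<Union>k\<le>Suc n. {a k <..< paint_end a m k}) \<subseteq> ?V \<union> {?c .. ?c + m (Suc n)}"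
  proof -
    \<comment> \<open>Such an \<open>x\<close> forces \<open>?c\<close> to be the old paint end, and
      \<open>a n \<le> a (Suc n) < x\<close>, so interval \<open>n\<close> contains it. The point
      \<open>?c\<close> itself may be new, hence the closed interval.\<close>
    have "x \<in> ?V" if "a (Suc n) < x" "x < ?c" for x
      using that monoD[OF assms(1), of n "Suc n"] by (intro UN_I[of n]) auto
    then have "{a (Suc n) <..< paint_end a m (Suc n)} \<subseteq> ?V \<union> {?c .. ?c + m (Suc n)}"
      by (intro subsetI) (metis UnI1 UnI2 atLeastAtMost_iff greaterThanLessThan_iff linorder_not_less
          order_less_imp_le paint_end.simps(2))
    then show ?thesis
      by (simp only: atMost_Suc UN_insert Un_subset_iff) blast
  qed
  then have "emeasure lborel (\<Union>k\<le>Suc n. {a k <..< paint_end a m k})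
      \<le> emeasure lborel (?V \<union> {?c .. ?c + m (Suc n)})"
    by (intro emeasure_mono) auto
  also have "\<dots> \<le> emeasure lborel ?V + emeasure lborel {?c .. ?c + m (Suc n)}"
    by (intro emeasure_subadditive) auto
  also have "\<dots> \<le> ennreal (\<Sum>j\<le>n. m j) + ennreal (m (Suc n))"
    using Suc assms(2) by (intro add_mono) auto
  also have "\<dots> = ennreal (\<Sum>j\<le>Suc n. m j)"
    using assms(2) by (simp add: sum_nonneg)
  finally show ?case .
qed

text \<open>Continuity of the measure from below along the finite stages.\<close>

lemma emeasure_painted_le_suminf:
  assumes "mono a" "\<And>i. 0 \<le> m i" "summable m"
  shows "emeasure lborel (\<Union>k. {a k <..< paint_end a m k}) \<le> ennreal (\<Sum>j. m j)"
proof -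
  let ?V = "\<lambda>n. \<Union>k\<le>n. {a k <..< paint_end a m k}"
  have "(\<Union>k. {a k <..< paint_end a m k}) = (\<Union>n. ?V n)"
    by auto
  also have "emeasure lborel \<dots> = (SUP n. emeasure lborel (?V n))"
    by (rule SUP_emeasure_incseq[symmetric]) (auto simp: incseq_def intro: order_trans)
  also have "\<dots> \<le> ennreal (\<Sum>j. m j)"
  proof (rule SUP_least)
    fix n
    have "(\<Sum>j\<le>n. m j) \<le> (\<Sum>j. m j)"
      using assms by (intro sum_le_suminf) auto
    then show "emeasure lborel (?V n) \<le> ennreal (\<Sum>j. m j)"
      using emeasure_painted_le_sum[OF assms(1,2)] by (meson ennreal_leI order_trans)
  qed
  finally show ?thesis .
qed

text \<open>Gives the painted set intervals whose ends involve only finite sums of \<open>m\<close>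
  and no maxima, so that they can be approximated from below.\<close>

lemma painted_interval_subset:
  assumes "mono a" "\<And>i. 0 \<le> m i"
  shows "{a (i + d) <..< a i + (\<Sum>j<d. m (i + j))} \<subseteq> (\<Union>k. {a k <..< paint_end a m k})"
proof -
  have "a i + (\<Sum>j<d. m (i + j)) \<le> a i + (\<Sum>j\<le>d. m (i + j))"
    using assms(2) by (intro add_left_mono sum_mono2) auto
  also have "\<dots> \<le> paint_end a m (i + d)"
    by (rule paint_end_ge) (rule assms(2))
  finally show ?thesis
    by (intro subset_trans[OF _ UN_upper[of "i + d"]]) auto
qed

section \<open>The test that captures \<alpha>\<close>

theorem theorem7:
  fixes a :: "nat \<Rightarrow> rat" and \<alpha> :: real
  assumes "computable_rat_seq a"
    and "mono a"
    and "(\<lambda>i. real_of_rat (a i)) \<longlonglongrightarrow> \<alpha>"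
    and "\<exists>h :: rat \<Rightarrow> nat \<Rightarrow> real.
      uniformly_lower_semicomputable h \<and>
      (\<forall>\<epsilon> > 0.
        (\<forall>i. 0 \<le> h \<epsilon> i) \<and>
        summable (h \<epsilon>) \<and> (\<Sum>i. h \<epsilon> i) < real_of_rat \<epsilon> \<and>
        (\<exists>i. \<alpha> \<le> real_of_rat (a i) + (\<Sum>j. h \<epsilon> (i + j))))"
  shows "\<not> martin_loef_random \<alpha>"
proof (cases "\<exists>i. real_of_rat (a i) = \<alpha>")
  case True
  then show ?thesis
    using rational_not_martin_loef_random by blast
next
  case False
  define A where "A i = real_of_rat (a i)" for i
  have A: "mono A"
    using \<open>mono a\<close> by (auto simp: A_def mono_def of_rat_less_eq)
  have "A \<longlonglongrightarrow> \<alpha>"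
    using assms(3) by (simp add: A_def[abs_def])
  then have "A i \<le> \<alpha>" for i
    using A by (metis incseq_le)
  then have less: "A i < \<alpha>" for i
    using False by (metis A_def order_le_less)
  obtain ga where ga: "general_recursive 1 ga" "\<And>i. a i = rat_decode (ga [i])"
    using assms(1) unfolding computable_rat_seq_def by blast
  obtain h where h: "uniformly_lower_semicomputable h"
    and bound: "\<forall>\<epsilon> > 0. (\<forall>i. 0 \<le> h \<epsilon> i) \<and> summable (h \<epsilon>) \<and> (\<Sum>i. h \<epsilon> i) < real_of_rat \<epsilon> \<and>
        (\<exists>i. \<alpha> \<le> real_of_rat (a i) + (\<Sum>j. h \<epsilon> (i + j)))"
    using assms(4) by (elim exE conjE)
  have nonneg: "0 \<le> h \<epsilon> i" and summable: "summable (h \<epsilon>)"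
    and sum_less: "(\<Sum>i. h \<epsilon> i) < real_of_rat \<epsilon>"
    and le_tail: "\<exists>i. \<alpha> \<le> A i + (\<Sum>j. h \<epsilon> (i + j))" if "\<epsilon> > 0" for \<epsilon> i
    using bound[rule_format, OF that] by (simp_all add: A_def)
  obtain g where g: "general_recursive 3 g"
    and approx: "\<And>e i. rat_decode e > 0 \<Longrightarrow>
      approximates_from_below (\<lambda>n. rat_decode (g [e, i, n])) (h (rat_decode e) i)"
    using h unfolding uniformly_lower_semicomputable_def by blast
  \<comment> \<open>The algorithm \<open>g\<close> reads a code of \<epsilon>, so such a code is
    computed from \<open>n\<close>. The exponent \<open>Suc n\<close> leaves room for doubling the
    paint within the bound \<open>(1 / 2) ^ n\<close>.\<close>
  have "computable_rat 1 (\<lambda>xs. (1 / 2) ^ Suc (xs ! 0))"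
    by (intro computable_rat_half_power computable_Suc computable_nth) auto
  then obtain c where c: "computable 1 c"
    and c_eq: "\<And>xs. length xs = 1 \<Longrightarrow> (1 / 2) ^ Suc (xs ! 0) = rat_decode (c xs)"
    unfolding computable_rat_def by blast
  define \<epsilon> :: "nat \<Rightarrow> rat" where "\<epsilon> n = (1 / 2) ^ Suc n" for n
  have c_eq: "rat_decode (c [n]) = \<epsilon> n" for n
    using c_eq[of "[n]"] by (simp add: \<epsilon>_def)
  have \<epsilon>: "\<epsilon> n > 0" for n
    by (simp add: \<epsilon>_def)
  define r where "r n i N = rat_decode (g [c [n], i, N])" for n i N
  have r_mono: "mono (r n i)" and r_lim: "(\<lambda>N. real_of_rat (r n i N)) \<longlonglongrightarrow> h (\<epsilon> n) i" for n i
    using approx[of "c [n]" i] \<epsilon>[of n] by (simp_all add: c_eq approximates_from_below_def r_def[abs_def])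
  have r_le: "real_of_rat (r n i N) \<le> h (\<epsilon> n) i" for n i N
  proof -
    have "incseq (\<lambda>N. real_of_rat (r n i N))"
      using r_mono[of n i] by (simp add: mono_def of_rat_less_eq)
    then show ?thesis
      using r_lim by (rule incseq_le)
  qed
  \<comment> \<open>Both the tail and the amounts in it are cut to finite stages: \<open>d\<close>
    terms, each replaced by its approximation at stage \<open>N\<close>. This makes the ends of
    \<open>I\<close> rational and computable; the factor 2 is the doubled paint.\<close>
  define s where "s n i d N = (\<Sum>j<d. r n (i + j) N)" for n i d N
  define I where "I n i d N = {A (i + d) <..< A i + 2 * real_of_rat (s n i d N)}" for n i d N
  define U where "U n = (\<Union>i d N. I n i d N)" for n
  \<comment> \<open>One index \<open>k\<close> codes the triple of \<open>i\<close>,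
    \<open>d\<close> and \<open>N\<close>, as a single enumeration of intervals is required.\<close>
  define i_of d_of N_of where "i_of k = fst (prod_decode k)"
    and "d_of k = fst (prod_decode (snd (prod_decode k)))"
    and "N_of k = snd (prod_decode (snd (prod_decode k)))" for k
  note index_defs = i_of_def d_of_def N_of_def
  have "uniformly_effectively_open U"
  proof (rule uniformly_effectively_openI)
    have ga': "computable 1 ga"
      using ga(1) by (rule general_recursive_imp_computable)
    have g': "computable 3 g"
      using g by (rule general_recursive_imp_computable)
    have a: "computable_rat k (\<lambda>xs. a (f xs))" if "computable k f" for k f
      unfolding ga(2) by (intro computable_rat_decode computable_list1[OF ga'] that)
    show "computable_rat 2 (\<lambda>xs. a (i_of (xs ! 1) + d_of (xs ! 1)))"
      unfolding index_defs
      by (intro a computable_add computable_fst_prod_decode computable_snd_prod_decode computable_nth)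
        auto
    \<comment> \<open>Position 0 is the summation index, which moves \<open>n\<close> and
      \<open>k\<close> to positions 1 and 2.\<close>
    have "computable_rat (2 + 1) (\<lambda>ys. r (ys ! 1) (i_of (ys ! 2) + ys ! 0) (N_of (ys ! 2)))"
      unfolding r_def index_defs
      by (intro computable_rat_decode computable_list3[OF g'] computable_list1[OF c] computable_add
          computable_fst_prod_decode computable_snd_prod_decode computable_nth) auto
    moreover have "computable 2 (\<lambda>xs. d_of (xs ! 1))"
      unfolding d_of_def
      by (intro computable_fst_prod_decode computable_snd_prod_decode computable_nth) auto
    ultimately have "computable_rat 2 (\<lambda>xs. \<Sum>j<d_of (xs ! 1).
        (\<lambda>ys. r (ys ! 1) (i_of (ys ! 2) + ys ! 0) (N_of (ys ! 2))) (j # xs))"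
      by (rule computable_rat_sum)
    then have s: "computable_rat 2 (\<lambda>xs. s (xs ! 0) (i_of (xs ! 1)) (d_of (xs ! 1)) (N_of (xs ! 1)))"
      by (simp add: s_def numeral_2_eq_2)
    show "computable_rat 2 (\<lambda>xs. a (i_of (xs ! 1)) +
        (s (xs ! 0) (i_of (xs ! 1)) (d_of (xs ! 1)) (N_of (xs ! 1)) +
         s (xs ! 0) (i_of (xs ! 1)) (d_of (xs ! 1)) (N_of (xs ! 1))))"
      by (intro computable_rat_add s a)
        (auto simp: i_of_def intro!: computable_fst_prod_decode computable_nth)
    fix n
    have "U n = (\<Union>k. I n (i_of k) (d_of k) (N_of k))"
    proof (intro subset_antisym subsetI)
      fix x assume "x \<in> U n"
      then obtain i d N where "x \<in> I n i d N"
        unfolding U_def by blast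
      then show "x \<in> (\<Union>k. I n (i_of k) (d_of k) (N_of k))"
        by (intro UN_I[of "prod_encode (i, prod_encode (d, N))"]) (simp_all add: index_defs)
    qed (auto simp: U_def)
    then show "U n = (\<Union>k. {real_of_rat (a (i_of ([n, k] ! 1) + d_of ([n, k] ! 1))) <..<
        real_of_rat (a (i_of ([n, k] ! 1)) +
        (s ([n, k] ! 0) (i_of ([n, k] ! 1)) (d_of ([n, k] ! 1)) (N_of ([n, k] ! 1)) +
         s ([n, k] ! 0) (i_of ([n, k] ! 1)) (d_of ([n, k] ! 1)) (N_of ([n, k] ! 1))))})"
      by (simp add: I_def A_def of_rat_add of_rat_mult)
  qed
  moreover have "emeasure lborel (U n) \<le> ennreal ((1 / 2) ^ n)" for n
  proof -
    define m where "m i = 2 * h (\<epsilon> n) i" for i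
    have m: "\<And>i. 0 \<le> m i" "summable m"
      using nonneg[OF \<epsilon>] summable[OF \<epsilon>] by (auto simp: m_def[abs_def])
    have "I n i d N \<subseteq> (\<Union>k. {A k <..< paint_end A m k})" for i d N
    proof -
      \<comment> \<open>Approximations from below never overshoot, so every interval
        \<open>I\<close> stays inside the set painted with the true amounts
        \<open>m\<close>.\<close>
      have "real_of_rat (s n i d N) \<le> (\<Sum>j<d. h (\<epsilon> n) (i + j))"
        unfolding s_def of_rat_sum by (intro sum_mono r_le)
      then have "I n i d N \<subseteq> {A (i + d) <..< A i + (\<Sum>j<d. m (i + j))}"
        by (auto simp: I_def m_def simp flip: sum_distrib_left)
      also have "\<dots> \<subseteq> (\<Union>k. {A k <..< paint_end A m k})"
        by (rule painted_interval_subset[OF A m(1)])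
      finally show ?thesis .
    qed
    then have "U n \<subseteq> (\<Union>k. {A k <..< paint_end A m k})"
      unfolding U_def by blast
    then have "emeasure lborel (U n) \<le> emeasure lborel (\<Union>k. {A k <..< paint_end A m k})"
      by (intro emeasure_mono) auto
    also have "\<dots> \<le> ennreal (\<Sum>j. m j)"
      by (rule emeasure_painted_le_suminf[OF A m])
    also have "(\<Sum>j. m j) = 2 * (\<Sum>i. h (\<epsilon> n) i)"
      unfolding m_def by (rule suminf_mult) (rule summable[OF \<epsilon>])
    also have "\<dots> \<le> 2 * real_of_rat (\<epsilon> n)"
      using sum_less[OF \<epsilon>, of n] by simp
    also have "\<dots> = (1 / 2) ^ n"
      by (simp add: \<epsilon>_def of_rat_mult of_rat_power of_rat_divide)
    finally show ?thesis
      by (simp add: ennreal_leI)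
  qed
  ultimately have "martin_loef_test U"
    by (simp add: martin_loef_test_def)
  moreover have "\<alpha> \<in> U n" for n
  proof -
    obtain i where i: "\<alpha> \<le> A i + (\<Sum>j. h (\<epsilon> n) (i + j))"
      using le_tail[OF \<epsilon>] by blast
    let ?H = "\<lambda>d. \<Sum>j<d. h (\<epsilon> n) (i + j)"
    have "summable (\<lambda>j. h (\<epsilon> n) (i + j))"
      using summable_ignore_initial_segment[OF summable[OF \<epsilon>], of n i] by (simp add: add.commute)
    then have "?H \<longlonglongrightarrow> (\<Sum>j. h (\<epsilon> n) (i + j))"
      by (rule summable_LIMSEQ)
    \<comment> \<open>Doubling pays off here: half of the positive gap is strictly below the tail
      sum, and a strict inequality survives the passage first to a finite \<open>d\<close>, then to
      a finite \<open>N\<close>.\<close>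
    moreover have "(\<alpha> - A i) / 2 < (\<Sum>j. h (\<epsilon> n) (i + j))"
    proof -
      have "(\<alpha> - A i) / 2 < \<alpha> - A i"
        using less[of i] by simp
      also have "\<dots> \<le> (\<Sum>j. h (\<epsilon> n) (i + j))"
        using i by simp
      finally show ?thesis .
    qed
    ultimately have "\<forall>\<^sub>F d in sequentially. (\<alpha> - A i) / 2 < ?H d"
      by (rule order_tendstoD(1))
    then obtain d where d: "(\<alpha> - A i) / 2 < ?H d"
      by (auto simp: eventually_sequentially)
    have "(\<lambda>N. real_of_rat (s n i d N)) \<longlonglongrightarrow> ?H d"
      unfolding s_def of_rat_sum by (intro tendsto_sum r_lim)
    then have "\<forall>\<^sub>F N in sequentially. (\<alpha> - A i) / 2 < real_of_rat (s n i d N)"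
      using d by (rule order_tendstoD(1))
    then obtain N where "(\<alpha> - A i) / 2 < real_of_rat (s n i d N)"
      by (auto simp: eventually_sequentially)
    \<comment> \<open>The left end lies below \<alpha> because no term of the sequence reaches
      \<alpha>.\<close>
    then have "\<alpha> \<in> I n i d N"
      using less[of "i + d"] by (simp add: I_def field_simps)
    then show ?thesis
      unfolding U_def by blast
  qed
  ultimately show ?thesis
    unfolding martin_loef_random_def by blast
qed

end
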